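(* Fix $\mathbf{x}$ and suppose $\boldsymbol{\psi}(\mathbf{x},\cdot)\in L^1(0,1]$. Let $\tilde{\boldsymbol{h}}(\mathbf{x},\cdot)$ be a function that is differentiable on $(0,1]$. Then the following are equivalent: 1. $\tilde{\boldsymbol{h}}$ satisfies $s\,\partial_s \tilde{\boldsymbol{h}}(\mathbf{x},s) + \tilde{\boldsymbol{h}}(\mathbf{x},s) = \boldsymbol{\psi}(\mathbf{x},s)$ for almost every $s\in(0,1]$, together with the boundary condition $\lim_{s\to 0} s\,\tilde{\boldsymbol{h}}(\mathbf{x},s)=0$; 2. $\tilde{\boldsymbol{h}}(\mathbf{x},s)=\frac{1}{s}\int_0^s \boldsymbol{\psi}(\mathbf{x},t)\,\mathrm{d}t$ for all $s\in(0,1]$.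
   Context: Here $\mathbf{x}$ is a fixed parameter (an element of some set), and $\boldsymbol{\psi}(\mathbf{x},\cdot)$ and $\tilde{\boldsymbol{h}}(\mathbf{x},\cdot)$ are functions of $s\in(0,1]$ with values in a common finite-dimensional real vector space $\mathbb{R}^q$. The notation $\partial_s$ denotes the derivative in $s$ (one-sided at the endpoint $s=1$), and the limit $s\to 0$ is taken through $s\in(0,1]$. Integrals are Lebesgue integrals. *)

theory Defs
  imports "HOL-Analysis.Analysis"
begin

end

theory Submission
  imports Defs
begin

text \<open>Multiplying by \<open>s\<close> turns the equation into \<open>G' = \<psi>\<close> for \<open>G s = s h(s)\<close>. Since \<open>G\<close> is
differentiable at \<^emph>\<open>every\<close> point, \<open>G'\<close> is Henstock-Kurzweil integrable with integral given by the
increments of \<open>G\<close>, without any absolute continuity of \<open>G\<close>; this gives one direction.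
Conversely, an indefinite integral has its integrand as right derivative almost everywhere, and
where \<open>G\<close> is differentiable the right derivative already determines \<open>G'\<close>.\<close>

text \<open>\<open>integrable_ccontinuous_explicit\<close> gives, off a negligible set, convergence
  of averages over cubes with lower corner \<open>x\<close>. On the line these averages are right
  difference quotients of the indefinite integral, hence the one-sided derivative.\<close>

lemma integral_has_vector_derivative_at_right_ae:
  fixes f :: "real \<Rightarrow> 'a::euclidean_space"
  assumes f: "f integrable_on {a..b}"
  obtains N where "negligible N"
    "\<And>x. x \<in> {a<..<b} - N \<Longrightarrow>
       ((\<lambda>y. integral {a..y} f) has_vector_derivative f x) (at_right x)"
proof -
  \<comment> \<open>Extension by zero, since the averaging result asks for integrability on every
    box.\<close>
  define F where "F = (\<lambda>t. if t \<in> {a..b} then f t else 0)"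
  have "F integrable_on UNIV"
    using f unfolding F_def by (rule integrable_restrict_UNIV[THEN iffD2])
  then have "F integrable_on cbox c d" for c d
    by (rule integrable_on_subcbox) simp
  then obtain N where N: "negligible N"
    and lim: "\<And>x e. \<lbrakk>x \<notin> N; 0 < e\<rbrakk> \<Longrightarrow> \<exists>d>0. \<forall>h. 0 < h \<and> h < d \<longrightarrow>
            norm (integral (cbox x (x + h *\<^sub>R One)) F /\<^sub>R h ^ DIM(real) - F x) < e"
    using integrable_ccontinuous_explicit[of F] by metis
  show thesis
  proof
    fix x assume x: "x \<in> {a<..<b} - N"
    let ?I = "\<lambda>y. integral {a..y} f"
    have "((\<lambda>y. (?I y - ?I x) /\<^sub>R (y - x) - f x) \<longlongrightarrow> 0) (at_right x)"
    proof (rule tendstoI)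
      fix e :: real assume "0 < e"
      then obtain d where "d > 0" and
        d: "\<And>h. \<lbrakk>0 < h; h < d\<rbrakk> \<Longrightarrow> norm (integral {x..x + h} F /\<^sub>R h - F x) < e"
        using lim[of x e] x by auto
      \<comment> \<open>The bound \<open>b\<close> keeps \<open>{x..y}\<close> where
        \<open>F\<close> agrees with \<open>f\<close>; the bound \<open>x + d\<close> makes
        \<open>y - x\<close> an admissible \<open>h\<close>.\<close>
      have "dist ((?I y - ?I x) /\<^sub>R (y - x) - f x) 0 < e" if "y \<in> {x<..<min b (x + d)}" for y
      proof -
        have y: "x < y" "y < b" "y - x < d" using that by auto
        have "?I x + integral {x..y} f = ?I y"
          using x y by (intro Henstock_Kurzweil_Integration.integral_combine
              integrable_on_subinterval[OF f]) auto
        moreover have "integral {x..y} f = integral {x..y} F"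
          using x y by (intro integral_cong) (auto simp: F_def)
        ultimately have "?I y - ?I x = integral {x..x + (y - x)} F"
          by (simp add: algebra_simps)
        with d[of "y - x"] x y show ?thesis
          by (simp add: F_def dist_norm)
      qed
      moreover have "eventually (\<lambda>y. y \<in> {x<..<min b (x + d)}) (at_right x)"
        using x \<open>d > 0\<close> by (intro eventually_at_right_real) auto
      ultimately show "\<forall>\<^sub>F y in at_right x. dist ((?I y - ?I x) /\<^sub>R (y - x) - f x) 0 < e"
        by (auto elim: eventually_mono)
    qed
    moreover have "\<forall>\<^sub>F y in at_right x. (?I y - ?I x) /\<^sub>R (y - x) - f x =
        (?I y - (?I x + (y - x) *\<^sub>R f x)) /\<^sub>R norm (y - x)"
      using eventually_at_right_less[of x]
      by eventually_elim (simp add: scaleR_diff_right scaleR_add_right)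
    ultimately have "((\<lambda>y. (?I y - (?I x + (y - x) *\<^sub>R f x)) /\<^sub>R norm (y - x)) \<longlongrightarrow> 0) (at_right x)"
      by (rule Lim_transform_eventually)
    then show "(?I has_vector_derivative f x) (at_right x)"
      by (simp add: has_vector_derivative_def has_derivative_within bounded_linear_scaleR_left
          flip: inverse_eq_divide)
  qed (rule N)
qed

text \<open>The equation makes \<open>G\<close> minus the indefinite integral constant. As that
  integral tends to 0 at \<open>a\<close>, the limit of \<open>G\<close> there decides the
  constant.\<close>

lemma derivative_ae_eq_iff_eq_integral:
  fixes f :: "real \<Rightarrow> 'a::euclidean_space"
  assumes f: "f integrable_on {a..b}" and "a < b"
    and D: "\<And>s. s \<in> {a<..b} \<Longrightarrow> (G has_vector_derivative D s) (at s within {a<..b})"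
  shows "(AE s in lebesgue. s \<in> {a<..b} \<longrightarrow> D s = f s) \<and> (G \<longlongrightarrow> 0) (at a within {a<..b})
    \<longleftrightarrow> (\<forall>s\<in>{a<..b}. G s = integral {a..s} f)" (is "?ae \<and> ?lim \<longleftrightarrow> ?int")
proof -
  let ?I = "\<lambda>y. integral {a..y} f"
  have "continuous_on {a..b} ?I"
    by (rule indefinite_integral_continuous_1[OF f])
  then have "(?I \<longlongrightarrow> ?I a) (at a within {a..b})"
    using \<open>a < b\<close> unfolding continuous_on_def by (metis atLeastAtMost_iff less_imp_le order_refl)
  then have "(?I \<longlongrightarrow> ?I a) (at a within {a<..b})"
    by (rule tendsto_within_subset) auto
  then have lim0: "(?I \<longlongrightarrow> 0) (at a within {a<..b})"
    by simp
  have nbot: "at a within {a<..b} \<noteq> bot"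
    using \<open>a < b\<close> by (simp add: at_within_eq_bot_iff)
  show ?thesis
  proof (intro iffI conjI)
    assume "?ae \<and> ?lim"
    then have ?lim and "negligible {s. \<not> (s \<in> {a<..b} \<longrightarrow> D s = f s)}" (is "negligible ?N")
      by (auto simp: eventually_ae_filter negligible_iff_null_sets
          intro: negligible_subset[unfolded negligible_iff_null_sets])
    \<comment> \<open>\<open>G\<close> is differentiable only on the half-open interval, so the
      fundamental theorem is applied from some \<open>e > a\<close>; \<open>a\<close> is reached
      afterwards by a limit.\<close>
    have incr: "G e - ?I e = G s - ?I s" if "a < e" "e \<le> s" "s \<le> b" for e s
    proof -
      have "(D has_integral (G s - G e)) {e..s}"
        using that by (intro fundamental_theorem_of_calculus has_vector_derivative_within_subset[OF D]) auto
      then have "(f has_integral (G s - G e)) {e..s}"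
        using that by (intro has_integral_spike[OF \<open>negligible ?N\<close>, of "{e..s}" f D]) auto
      moreover have "?I e + integral {e..s} f = ?I s"
        using that by (intro Henstock_Kurzweil_Integration.integral_combine
            integrable_on_subinterval[OF f]) auto
      ultimately show ?thesis
        by (auto simp: integral_unique algebra_simps)
    qed
    show ?int
    proof
      fix s assume s: "s \<in> {a<..b}"
      have "((\<lambda>e. G e - ?I e) \<longlongrightarrow> 0) (at a within {a<..b})"
        using tendsto_diff[OF \<open>?lim\<close> lim0] by simp
      \<comment> \<open>The two instances of \<open>incr\<close> cover \<open>e\<close> on either
        side of \<open>s\<close>.\<close>
      moreover have "\<forall>\<^sub>F e in at a within {a<..b}. G e - ?I e = G s - ?I s"
        using incr[of s] incr[of _ s] s
        by (smt (verit, best) eventually_at_filter eventually_mono greaterThanAtMost_iff always_eventually)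
      ultimately have "((\<lambda>e. G s - ?I s) \<longlongrightarrow> 0) (at a within {a<..b})"
        using tendsto_cong by force
      then show "G s = ?I s"
        using nbot by (simp add: tendsto_const_iff)
    qed
  next
    assume ?int
    then show ?lim
      using lim0 by (auto elim!: tendsto_cong[THEN iffD2, rotated] simp: eventually_at_filter)
    obtain N where N: "negligible N" and
      right: "\<And>x. x \<in> {a<..<b} - N \<Longrightarrow> (?I has_vector_derivative f x) (at_right x)"
      using integral_has_vector_derivative_at_right_ae[OF f] by blast
    \<comment> \<open>Restricted to \<open>{s<..<b}\<close>, both \<open>D s\<close> and
      \<open>f s\<close> are right derivatives of the same function at \<open>s\<close>, so they
      agree.\<close>
    have "D s = f s" if s: "s \<in> {a<..<b} - N" for s
    proof (rule vector_derivative_unique_within)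
      have "(?I has_vector_derivative D s) (at s within {a<..b})"
        using \<open>?int\<close> s by (intro has_vector_derivative_transform[OF _ _ D]) auto
      then show "(?I has_vector_derivative D s) (at s within {s<..<b})"
        by (rule has_vector_derivative_within_subset) (use s in auto)
      show "(?I has_vector_derivative f s) (at s within {s<..<b})"
        by (rule has_vector_derivative_within_subset[OF right[OF s]]) auto
      show "at s within {s<..<b} \<noteq> bot"
        using s by (simp add: at_within_eq_bot_iff)
    qed
    \<comment> \<open>No right derivative is available at \<open>b\<close>, so \<open>b\<close>
      joins the exceptional set.\<close>
    then have "{s. \<not> (s \<in> {a<..b} \<longrightarrow> D s = f s)} \<subseteq> insert b N"
      by force
    moreover have "insert b N \<in> null_sets lebesgue"
      using N by (simp flip: negligible_iff_null_sets)
    ultimately show ?ae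
      by (auto simp: eventually_ae_filter)
  qed
qed

theorem proposition2:
  fixes \<psi> h :: "'x \<Rightarrow> real \<Rightarrow> real ^ 'q"
    and x :: 'x
  assumes "set_integrable lebesgue {0<..1} (\<psi> x)"
    and "h x differentiable_on {0<..1}"
  shows "((AE s in lebesgue. s \<in> {0<..1} \<longrightarrow>
              s *\<^sub>R vector_derivative (h x) (at s within {0<..1}) + h x s = \<psi> x s)
          \<and> ((\<lambda>s. s *\<^sub>R h x s) \<longlongrightarrow> 0) (at 0 within {0<..1}))
     \<longleftrightarrow> (\<forall>s\<in>{0<..1}. h x s = (1 / s) *\<^sub>R (LINT t:{0<..s}|lebesgue. \<psi> x t))"
proof -
  have closed: "integral {0..s} (\<psi> x) = integral {0<..s} (\<psi> x)" for s
    by (rule integral_spike_set)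
      (auto intro: negligible_subset[of "{0}"])
  have "\<psi> x integrable_on {0..1}"
    using set_lebesgue_integral_eq_integral(1)[OF assms(1)]
    by (rule integrable_spike_set) (auto intro: negligible_subset[of "{0}"])
  \<comment> \<open>The product rule identifies the left side of the equation as the derivative
    \<open>D\<close> of \<open>G s = s h(s)\<close>.\<close>
  moreover have "((\<lambda>s. s *\<^sub>R h x s) has_vector_derivative
      s *\<^sub>R vector_derivative (h x) (at s within {0<..1}) + h x s) (at s within {0<..1})"
    if "s \<in> {0<..1}" for s
  proof -
    have "(h x has_vector_derivative vector_derivative (h x) (at s within {0<..1})) (at s within {0<..1})"
      using assms(2) that by (simp add: differentiable_on_def vector_derivative_works)
    from has_vector_derivative_scaleR[OF DERIV_ident this] show ?thesis by simp
  qed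
  \<comment> \<open>Passage from the Lebesgue to the Henstock-Kurzweil integral, followed by
    multiplication by \<open>s > 0\<close>.\<close>
  moreover have "h x s = (1 / s) *\<^sub>R (LINT t:{0<..s}|lebesgue. \<psi> x t) \<longleftrightarrow>
      s *\<^sub>R h x s = integral {0..s} (\<psi> x)" if "s \<in> {0<..1}" for s
  proof -
    have "set_integrable lebesgue {0<..s} (\<psi> x)"
      using that by (intro set_integrable_subset[OF assms(1)]) auto
    then have "(LINT t:{0<..s}|lebesgue. \<psi> x t) = integral {0..s} (\<psi> x)"
      by (simp add: set_lebesgue_integral_eq_integral(2) closed)
    moreover have "v = (1 / s) *\<^sub>R w \<longleftrightarrow> s *\<^sub>R v = w" for v w :: "real ^ 'q"
      using that by auto
    ultimately show ?thesis
      by simp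
  qed
  ultimately show ?thesis
    by (subst derivative_ae_eq_iff_eq_integral) auto
qed

end
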